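(* Quantum ergodicity does not hold in general for Dirichlet-truncated periodic Schrödinger operators. That is, there exist an integer $d\ge1$, a period vector $q=(q_1,\dots,q_d)\in\mathbb{N}^d$ and a potential $V:\mathbb{Z}^d\to\mathbb{R}$, periodic with respect to the lattice $\mathbb{L}=\{n_1q_1e_1+\cdots+n_dq_de_d:\ n_1,\dots,n_d\in\mathbb{Z}\}$, such that quantum ergodicity (as defined in the context) fails for the associated sequence of operators $\mathcal{H}_{\Lambda_N}$, $N\in\mathbb{N}$.
   Context: $\mathbb{N}$ denotes the positive integers and $e_1,\dots,e_d$ the standard basis of $\mathbb{Z}^d$. Periodicity of $V$ means $V(x+y)=V(x)$ for all $x\in\mathbb{Z}^d$, $y\in\mathbb{L}$. Put $\Lambda_N:=\prod_{l=1}^d\{1,\dots,q_lN\}$, and let $\ell^2(\Lambda_N)$ be the space of functions $\Lambda_N\to\mathbb{C}$ with inner product $\langle\varphi,\psi\rangle=\sum_{x\in\Lambda_N}\overline{\varphi(x)}\psi(x)$. The Dirichlet truncation $\mathcal{H}_{\Lambda_N}:\ell^2(\Lambda_N)\to\ell^2(\Lambda_N)$ is $$(\mathcal{H}_{\Lambda_N}\psi)(x)=\sum_{y\in\Lambda_N,\ \|y-x\|_1=1}\psi(y)+V(x)\psi(x),\qquad x\in\Lambda_N.$$ Quantum ergodicity holds for $(\mathcal{H}_{\Lambda_N})_{N}$ if, for every choice of orthonormal bases $\{\psi_N^{(j)}\}_{j=1}^{\#\Lambda_N}$ of $\ell^2(\Lambda_N)$ consisting of eigenfunctions of $\mathcal{H}_{\Lambda_N}$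 and every sequence of diagonal observables $a_N:\Lambda_N\times\Lambda_N\to\mathbb{C}$ (i.e. $a_N(x,y)=0$ for $x\neq y$) with $\sup_{x\in\Lambda_N}|a_N(x,x)|\le1$ for all $N$, one has $$\lim_{N\to\infty}\frac{1}{\#\Lambda_N}\sum_{j=1}^{\#\Lambda_N}\Big|\sum_{x\in\Lambda_N}a_N(x,x)|\psi_N^{(j)}(x)|^2-\frac{1}{\#\Lambda_N}\sum_{x\in\Lambda_N}a_N(x,x)\Big|^2=0.$$ *)

theory Defs
  imports "HOL-Analysis.Analysis" "HOL-Library.FuncSet"
begin

text \<open>The dimension \<open>d\<close> is quantified inside formulas, so points of \<open>\<int>\<^sup>d\<close> are functions on
  the index set \<open>{1..d}\<close> with values in the integers, extensional (i.e. \<open>undefined\<close>)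
  outside \<open>{1..d}\<close>. Likewise a function on a finite set \<open>S\<close> is taken extensional on \<open>S\<close>, so that
  equality of functions is equality on \<open>S\<close>.\<close>

type_synonym point = "nat \<Rightarrow> int"

definition Zd :: "nat \<Rightarrow> point set" where
  "Zd d = {1..d} \<rightarrow>\<^sub>E UNIV"

definition padd :: "nat \<Rightarrow> point \<Rightarrow> point \<Rightarrow> point" where
  "padd d x y = (\<lambda>i\<in>{1..d}. x i + y i)"

definition stdbasis :: "nat \<Rightarrow> nat \<Rightarrow> point" where
  "stdbasis d l = (\<lambda>i\<in>{1..d}. if i = l then 1 else 0)"

definition period_lattice :: "nat \<Rightarrow> (nat \<Rightarrow> nat) \<Rightarrow> point set" where
  "period_lattice d q =
     range (\<lambda>n :: nat \<Rightarrow> int. \<lambda>i\<in>{1..d}. \<Sum>l=1..d. n l * int (q l) * stdbasis d l i)"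

text \<open>Only the values of \<open>V\<close> on \<open>Zd d\<close> matter here and below.\<close>

definition periodic_potential :: "nat \<Rightarrow> (nat \<Rightarrow> nat) \<Rightarrow> (point \<Rightarrow> real) \<Rightarrow> bool" where
  "periodic_potential d q V \<longleftrightarrow>
     (\<forall>x\<in>Zd d. \<forall>y\<in>period_lattice d q. V (padd d x y) = V x)"

definition lattice_box :: "nat \<Rightarrow> (nat \<Rightarrow> nat) \<Rightarrow> nat \<Rightarrow> point set" where
  "lattice_box d q N = (\<Pi>\<^sub>E l\<in>{1..d}. {1..int (q l * N)})"

definition dist1 :: "nat \<Rightarrow> point \<Rightarrow> point \<Rightarrow> int" where
  "dist1 d x y = (\<Sum>l=1..d. \<bar>x l - y l\<bar>)"

definition ell2 :: "'x set \<Rightarrow> ('x \<Rightarrow> complex) set" where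
  "ell2 S = S \<rightarrow>\<^sub>E UNIV"

definition ell2_inner :: "'x set \<Rightarrow> ('x \<Rightarrow> complex) \<Rightarrow> ('x \<Rightarrow> complex) \<Rightarrow> complex" where
  "ell2_inner S \<phi> \<psi> = (\<Sum>x\<in>S. cnj (\<phi> x) * \<psi> x)"

definition dirichlet_op ::
  "nat \<Rightarrow> (nat \<Rightarrow> nat) \<Rightarrow> (point \<Rightarrow> real) \<Rightarrow> nat \<Rightarrow> (point \<Rightarrow> complex) \<Rightarrow> (point \<Rightarrow> complex)" where
  "dirichlet_op d q V N \<psi> =
     (\<lambda>x\<in>lattice_box d q N. (\<Sum>y | y \<in> lattice_box d q N \<and> dist1 d y x = 1. \<psi> y) + of_real (V x) * \<psi> x)"

definition eigenfunction ::
  "'x set \<Rightarrow> (('x \<Rightarrow> complex) \<Rightarrow> ('x \<Rightarrow> complex)) \<Rightarrow> ('x \<Rightarrow> complex) \<Rightarrow> bool" where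
  "eigenfunction S H \<psi> \<longleftrightarrow>
     \<psi> \<in> ell2 S \<and> \<psi> \<noteq> (\<lambda>x\<in>S. 0) \<and> (\<exists>E :: complex. H \<psi> = (\<lambda>x\<in>S. E * \<psi> x))"

definition orthonormal_basis :: "'x set \<Rightarrow> nat set \<Rightarrow> (nat \<Rightarrow> 'x \<Rightarrow> complex) \<Rightarrow> bool" where
  "orthonormal_basis S J \<psi> \<longleftrightarrow>
     (\<forall>j\<in>J. \<psi> j \<in> ell2 S) \<and>
     (\<forall>j\<in>J. \<forall>k\<in>J. ell2_inner S (\<psi> j) (\<psi> k) = (if j = k then 1 else 0)) \<and>
     (\<forall>\<phi>\<in>ell2 S. \<exists>c :: nat \<Rightarrow> complex. \<phi> = (\<lambda>x\<in>S. \<Sum>j\<in>J. c j * \<psi> j x))"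

definition eigenbasis ::
  "'x set \<Rightarrow> (('x \<Rightarrow> complex) \<Rightarrow> ('x \<Rightarrow> complex)) \<Rightarrow> (nat \<Rightarrow> 'x \<Rightarrow> complex) \<Rightarrow> bool" where
  "eigenbasis S H \<psi> \<longleftrightarrow>
     orthonormal_basis S {1..card S} \<psi> \<and> (\<forall>j\<in>{1..card S}. eigenfunction S H (\<psi> j))"

definition diagonal_observable :: "'x set \<Rightarrow> ('x \<Rightarrow> 'x \<Rightarrow> complex) \<Rightarrow> bool" where
  "diagonal_observable S a \<longleftrightarrow> (\<forall>x\<in>S. \<forall>y\<in>S. x \<noteq> y \<longrightarrow> a x y = 0)"

definition quantum_variance ::
  "'x set \<Rightarrow> (nat \<Rightarrow> 'x \<Rightarrow> complex) \<Rightarrow> ('x \<Rightarrow> 'x \<Rightarrow> complex) \<Rightarrow> real" where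
  "quantum_variance S \<psi> a =
     1 / real (card S) *
       (\<Sum>j=1..card S.
          (cmod ((\<Sum>x\<in>S. a x x * of_real ((cmod (\<psi> j x))\<^sup>2))
                 - 1 / of_nat (card S) * (\<Sum>x\<in>S. a x x)))\<^sup>2)"

text \<open>The index \<open>N\<close> ranges over the positive integers; the index \<open>0\<close> is left unconstrained and
  does not affect the limit.\<close>

definition quantum_ergodic ::
  "(nat \<Rightarrow> 'x set) \<Rightarrow> (nat \<Rightarrow> ('x \<Rightarrow> complex) \<Rightarrow> ('x \<Rightarrow> complex)) \<Rightarrow> bool" where
  "quantum_ergodic \<Lambda> H \<longleftrightarrow>
     (\<forall>(\<psi> :: nat \<Rightarrow> nat \<Rightarrow> 'x \<Rightarrow> complex) (a :: nat \<Rightarrow> 'x \<Rightarrow> 'x \<Rightarrow> complex).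
        (\<forall>N\<ge>1. eigenbasis (\<Lambda> N) (H N) (\<psi> N)) \<longrightarrow>
        (\<forall>N\<ge>1. diagonal_observable (\<Lambda> N) (a N) \<and> (\<forall>x\<in>\<Lambda> N. cmod (a N x x) \<le> 1)) \<longrightarrow>
        (\<lambda>N. quantum_variance (\<Lambda> N) (\<psi> N) (a N)) \<longlonglongrightarrow> 0)"

end

theory Submission
  imports Defs
begin

text \<open>Take \<open>d = 1\<close>, \<open>q = 2\<close> and let both the potential and the observable be the sign \<open>\<sigma>(x) = (-1)^x\<close>,
  which has mean zero on the box. The sign anticommutes with the adjacency operator and squares to the
  identity, so \<open>\<sigma> H + H \<sigma> = 2\<close>; hence a normalised eigenfunction of energy \<open>E\<close> gives \<open>\<sigma>\<close> the
  expectation \<open>1 / E\<close>. Since \<open>E\<^sup>2 \<le> 5\<close>, the quantum variance stays above \<open>1 / 5\<close>. An explicit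
  eigenbasis comes from the Dirichlet sine modes, since \<open>\<sigma>\<close> maps mode \<open>k\<close> of the box with \<open>n - 1\<close>
  sites to minus mode \<open>n - k\<close>.\<close>

section \<open>Discrete sine modes\<close>

text \<open>This is the Dirichlet kernel: multiplied by \<open>2 * sin (\<theta> / 2)\<close>, the
  sum telescopes.\<close>

lemma sum_cos_eq:
  fixes \<theta> :: real
  assumes "sin (\<theta> / 2) \<noteq> 0" "n \<ge> 1"
  shows "(\<Sum>k=1..<n. cos (\<theta> * real k)) = (sin ((real n - 1/2) * \<theta>) / sin (\<theta> / 2) - 1) / 2"
proof -
  have "2 * sin (\<theta> / 2) * (\<Sum>k=1..<n. cos (\<theta> * real k)) = sin ((real n - 1/2) * \<theta>) - sin (\<theta> / 2)"
    using assms(2)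
  proof (induction n rule: dec_induct)
    case base
    then show ?case by simp
  next
    case (step m)
    have "2 * sin (\<theta> / 2) * (\<Sum>k=1..<Suc m. cos (\<theta> * real k)) =
        sin ((real m - 1/2) * \<theta>) - sin (\<theta> / 2) + 2 * sin (\<theta> / 2) * cos (\<theta> * real m)"
      using step by (simp only: sum.atLeastLessThan_Suc distrib_left)
    also have "(real m - 1/2) * \<theta> = \<theta> * real m - \<theta> / 2"
      by (simp add: algebra_simps)
    also have "sin (\<theta> * real m - \<theta> / 2) - sin (\<theta> / 2) + 2 * sin (\<theta> / 2) * cos (\<theta> * real m)
        = sin (\<theta> * real m + \<theta> / 2) - sin (\<theta> / 2)"
      unfolding sin_add sin_diff by (simp add: mult_ac)
    also have "\<theta> * real m + \<theta> / 2 = (real (Suc m) - 1/2) * \<theta>"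
      by (simp add: algebra_simps)
    finally show ?case .
  qed
  then have "2 * sin (\<theta> / 2) * (\<Sum>k=1..<n. cos (\<theta> * real k)) / sin (\<theta> / 2)
      = sin ((real n - 1/2) * \<theta>) / sin (\<theta> / 2) - 1"
    using assms(1) by (simp only: diff_divide_distrib) simp
  then show ?thesis
    using assms(1) by simp
qed

text \<open>At this angle the numerator of the kernel is the sine of
  \<open>pi * m - \<theta> / 2\<close>, so the quotient of sines collapses to a sign. The bounds on
  \<open>m\<close> put \<open>\<theta> / 2\<close> strictly between 0 and \<open>pi\<close>, away
  from the zeros of the denominator.\<close>

lemma sum_cos_pi_multiple:
  assumes "0 < m" "m < 2 * n"
  shows "(\<Sum>k=1..<n. cos (pi * real m / real n * real k)) = (- ((-1) ^ m) - 1) / 2"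
proof -
  define \<theta> where "\<theta> = pi * real m / real n"
  have n: "n \<ge> 1" using assms by linarith
  have "0 < \<theta> / 2" "\<theta> / 2 < pi"
    using assms n by (auto simp: \<theta>_def field_simps)
  then have nz: "sin (\<theta> / 2) \<noteq> 0"
    using sin_gt_zero[of "\<theta> / 2"] by simp
  have "(real n - 1/2) * \<theta> = pi * real m - \<theta> / 2"
    using n by (simp add: \<theta>_def field_simps)
  then have "sin ((real n - 1/2) * \<theta>) = - ((-1) ^ m) * sin (\<theta> / 2)"
    by (simp add: sin_diff cos_npi2)
  then show ?thesis
    using sum_cos_eq[OF nz n] nz by (simp flip: \<theta>_def)
qed

text \<open>Normalised Dirichlet eigenvectors of the path with sites \<open>1..n-1\<close>; the
  sites \<open>0\<close> and \<open>n\<close> are its boundary.\<close>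

definition sine_mode :: "nat \<Rightarrow> nat \<Rightarrow> nat \<Rightarrow> real" where
  "sine_mode n k m = sqrt (2 / real n) * sin (pi * real k * real m / real n)"

text \<open>By this symmetry, orthonormality in the site variable is also orthonormality in the mode
  variable, which later yields completeness.\<close>

lemma sine_mode_commute: "sine_mode n k m = sine_mode n m k"
  by (simp add: sine_mode_def mult_ac)

lemma sine_mode_boundary [simp]: "sine_mode n k 0 = 0" "n > 0 \<Longrightarrow> sine_mode n k n = 0"
  by (simp_all add: sine_mode_def)

text \<open>The product formula leaves cosine sums of frequencies \<open>b - a\<close> and
  \<open>a + b\<close>. These have equal parity, so the sums cancel unless \<open>a = b\<close>,
  when they are \<open>n - 1\<close> and \<open>-1\<close>.\<close>

lemma sine_mode_orthonormal:
  assumes "a \<in> {1..<n}" "b \<in> {1..<n}"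
  shows "(\<Sum>m=1..<n. sine_mode n a m * sine_mode n b m) = (if a = b then 1 else 0)"
  using assms
proof (induction a b rule: linorder_wlog)
  case (sym a b)
  then show ?case by (simp add: mult.commute eq_commute)
next
  case (le a b)
  have n: "n > 0" using le by auto
  have "sine_mode n a m * sine_mode n b m =
      (cos (pi * real (b - a) / real n * real m) - cos (pi * real (a + b) / real n * real m)) / real n" for m
  proof -
    have "cos (pi * real (b - a) / real n * real m) - cos (pi * real (a + b) / real n * real m)
        = 2 * sin (pi * real a * real m / real n) * sin (pi * real b * real m / real n)"
      using le(1)
      by (simp add: of_nat_diff ring_distribs add_divide_distrib diff_divide_distrib cos_add cos_diff mult_ac)
    then show ?thesis using n by (simp add: sine_mode_def field_simps)
  qed
  then have "(\<Sum>m=1..<n. sine_mode n a m * sine_mode n b m) =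
      ((\<Sum>m=1..<n. cos (pi * real (b - a) / real n * real m))
       - (\<Sum>m=1..<n. cos (pi * real (a + b) / real n * real m))) / real n"
    by (simp add: sum_subtractf flip: sum_divide_distrib)
  also have "(\<Sum>m=1..<n. cos (pi * real (a + b) / real n * real m)) = (- ((-1) ^ (a + b)) - 1) / 2"
    using le by (intro sum_cos_pi_multiple) auto
  also have "(\<Sum>m=1..<n. cos (pi * real (b - a) / real n * real m)) =
     (if a = b then real n - 1 else (- ((-1) ^ (a + b)) - 1) / 2)"
  proof (cases "a = b")
    case True
    then show ?thesis using n by (simp add: of_nat_diff)
  next
    case False
    then have "(\<Sum>m=1..<n. cos (pi * real (b - a) / real n * real m)) = (- ((-1) ^ (b - a)) - 1) / 2"
      using le by (intro sum_cos_pi_multiple) auto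
    also have "(-1 :: real) ^ (b - a) = (-1) ^ (a + b)"
      using le(1) by (simp add: minus_one_power_iff)
    finally show ?thesis using False by simp
  qed
  finally show ?case
    using n by (cases "a = b") (simp_all add: minus_one_power_iff)
qed

lemma sine_mode_laplacian:
  assumes "m \<ge> 1"
  shows "sine_mode n k (m - 1) + sine_mode n k (m + 1) = 2 * cos (pi * real k / real n) * sine_mode n k m"
proof -
  have "pi * real k * real (m - 1) / real n = pi * real k * real m / real n - pi * real k / real n"
    using assms by (simp add: of_nat_diff ring_distribs diff_divide_distrib)
  moreover have "pi * real k * real (m + 1) / real n = pi * real k * real m / real n + pi * real k / real n"
    by (simp add: ring_distribs add_divide_distrib)
  ultimately show ?thesis
    unfolding sine_mode_def by (simp only: sin_add sin_diff) (simp add: algebra_simps)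
qed

text \<open>Expand \<open>sin (pi * m - x)\<close>. The alternating potential thus couples mode
  \<open>k\<close> to mode \<open>n - k\<close> only.\<close>

lemma sine_mode_reflect:
  assumes "k \<le> n" "n > 0"
  shows "sine_mode n (n - k) m = - ((-1) ^ m * sine_mode n k m)"
proof -
  have "pi * real (n - k) * real m / real n = pi * real m - pi * real k * real m / real n"
    using assms by (simp add: of_nat_diff field_simps)
  then show ?thesis
    unfolding sine_mode_def by (simp only: sin_diff) (simp add: cos_npi2)
qed

section \<open>Eigenfunctions for the alternating potential\<close>

text \<open>Let \<open>n = 2N + 1\<close>, so that no index is fixed by \<open>k \<mapsto> n - k\<close>. On the span of the modes
  \<open>k\<close> and \<open>n - k\<close> the operator is the matrix with rows \<open>(\<lambda>, -1)\<close> and \<open>(-1, -\<lambda>)\<close>, where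
  \<open>\<lambda> = mode_freq N k\<close>; it has eigenvalues \<open>\<plusminus> sqrt (1 + \<lambda>\<^sup>2)\<close>, of which \<open>k\<close> gets one and
  \<open>n - k\<close> the other, and \<open>(1, mode_slope N k)\<close> is an eigenvector.\<close>

definition mode_freq :: "nat \<Rightarrow> nat \<Rightarrow> real" where
  "mode_freq N k = 2 * cos (pi * real k / real (2 * N + 1))"

definition mode_energy :: "nat \<Rightarrow> nat \<Rightarrow> real" where
  "mode_energy N k = (if k \<le> N then 1 else -1) * sqrt (1 + (mode_freq N k)\<^sup>2)"

definition mode_slope :: "nat \<Rightarrow> nat \<Rightarrow> real" where
  "mode_slope N k = mode_freq N k - mode_energy N k"

definition mode_scale :: "nat \<Rightarrow> nat \<Rightarrow> real" where
  "mode_scale N k = 1 / sqrt (1 + (mode_slope N k)\<^sup>2)"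

definition alt_mode :: "nat \<Rightarrow> nat \<Rightarrow> nat \<Rightarrow> real" where
  "alt_mode N k m = mode_scale N k *
     (sine_mode (2 * N + 1) k m + mode_slope N k * sine_mode (2 * N + 1) (2 * N + 1 - k) m)"

context
  fixes N k :: nat
  assumes k: "k \<in> {1..2 * N}"
begin

lemma mode_freq_reflect: "mode_freq N (2 * N + 1 - k) = - mode_freq N k"
proof -
  have "pi * real (2 * N + 1 - k) / real (2 * N + 1) = pi - pi * real k / real (2 * N + 1)"
    using k by (simp add: of_nat_diff divide_simps) (simp add: algebra_simps)
  then show ?thesis
    unfolding mode_freq_def by (simp only: cos_diff) simp
qed

text \<open>Reflection exchanges \<open>{1..N}\<close> with \<open>{N+1..2*N}\<close>, flipping the
  chosen sign, and keeps the squared frequency.\<close>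

lemma mode_energy_reflect: "mode_energy N (2 * N + 1 - k) = - mode_energy N k"
  using k unfolding mode_energy_def mode_freq_reflect by auto

text \<open>Oddness makes the vector \<open>(-t, 1)\<close> attached to \<open>n - k\<close>
  orthogonal to the vector \<open>(1, t)\<close> attached to \<open>k\<close>.\<close>

lemma mode_slope_reflect: "mode_slope N (2 * N + 1 - k) = - mode_slope N k"
  unfolding mode_slope_def mode_freq_reflect mode_energy_reflect by simp

lemma mode_scale_reflect: "mode_scale N (2 * N + 1 - k) = mode_scale N k"
  unfolding mode_scale_def mode_slope_reflect by simp

end

lemma mode_energy_sq: "(mode_energy N k)\<^sup>2 = 1 + (mode_freq N k)\<^sup>2"
  by (simp add: mode_energy_def power_mult_distrib)

lemma mode_energy_sq_le: "(mode_energy N k)\<^sup>2 \<le> 5"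
proof -
  have "(mode_freq N k)\<^sup>2 \<le> 2\<^sup>2"
    by (rule abs_le_square_iff[THEN iffD1]) (simp add: mode_freq_def abs_mult)
  then show ?thesis by (simp add: mode_energy_sq)
qed

lemma mode_energy_nonzero: "mode_energy N k \<noteq> 0"
proof -
  have "1 + (mode_freq N k)\<^sup>2 > 0" by (simp add: add_pos_nonneg)
  then show ?thesis by (metis mode_energy_sq less_irrefl zero_power2)
qed

lemma mode_scale_sq: "(mode_scale N k)\<^sup>2 * (1 + (mode_slope N k)\<^sup>2) = 1"
proof -
  have "1 + (mode_slope N k)\<^sup>2 > 0" by (simp add: add_pos_nonneg)
  then show ?thesis by (simp add: mode_scale_def power_divide)
qed

text \<open>Links the normalising constant to the energy; this is what turns the expectation of the
  sign into \<open>1 / E\<close>.\<close>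

lemma mode_slope_energy: "1 + (mode_slope N k)\<^sup>2 = - 2 * mode_energy N k * mode_slope N k"
  using mode_energy_sq[of N k] by (simp add: mode_slope_def power2_eq_square algebra_simps)

lemma alt_mode_boundary [simp]: "alt_mode N k 0 = 0" "alt_mode N k (2 * N + 1) = 0"
  by (simp_all only: alt_mode_def sine_mode_boundary) auto

lemma alt_mode_eigen:
  assumes k: "k \<in> {1..2 * N}" and m: "m \<ge> 1"
  shows "alt_mode N k (m - 1) + alt_mode N k (m + 1) + (-1) ^ m * alt_mode N k m
     = mode_energy N k * alt_mode N k m"
proof -
  define n where "n = 2 * N + 1"
  define \<alpha> t E l u v where defs: "\<alpha> = mode_scale N k" "t = mode_slope N k" "E = mode_energy N k"
    "l = mode_freq N k" "u = sine_mode n k m" "v = sine_mode n (n - k) m"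
  have v: "v = - ((-1) ^ m * u)" unfolding defs
    using k by (intro sine_mode_reflect) (auto simp: n_def)
  then have u: "u = - ((-1) ^ m * v)" by simp
  have lu: "sine_mode n k (m - 1) + sine_mode n k (m + 1) = l * u"
    using sine_mode_laplacian[OF m, of n k] by (simp add: defs mode_freq_def n_def)
  have lv: "sine_mode n (n - k) (m - 1) + sine_mode n (n - k) (m + 1) = - l * v"
    using sine_mode_laplacian[OF m, of n "n - k"] mode_freq_reflect[OF k]
    unfolding defs mode_freq_def n_def by simp
  have t: "t = l - E" by (simp add: defs mode_slope_def)
  have E: "E * E = 1 + l * l" using mode_energy_sq[of N k] by (simp add: defs power2_eq_square)
  have "alt_mode N k (m - 1) + alt_mode N k (m + 1) + (-1) ^ m * alt_mode N k m
     = \<alpha> * ((sine_mode n k (m - 1) + sine_mode n k (m + 1)) +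
             t * (sine_mode n (n - k) (m - 1) + sine_mode n (n - k) (m + 1)) +
             ((-1) ^ m * u + t * ((-1) ^ m * v)))"
    by (simp add: alt_mode_def defs n_def algebra_simps)
  also have "\<dots> = \<alpha> * (l * u + t * (- l * v) + (- v + t * (- u)))"
    unfolding lu lv using u v by simp
  also have "\<dots> = E * (\<alpha> * (u + t * v))"
    \<comment> \<open>Compare coefficients: \<open>l - t = E\<close> for \<open>u\<close>, and
      \<open>-1 - l * t = E * t\<close> for \<open>v\<close>, the latter by
      \<open>E * E = 1 + l * l\<close>.\<close>
    using E unfolding t by algebra
  also have "\<alpha> * (u + t * v) = alt_mode N k m"
    by (simp add: alt_mode_def defs n_def)
  finally show ?thesis by (simp add: defs)
qed

section \<open>Orthonormality, completeness and sign expectation of the eigenmodes\<close>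

lemma sine_mode_orthonormal':
  assumes "a \<in> {1..2 * N}" "b \<in> {1..2 * N}"
  shows "(\<Sum>m=1..2 * N. sine_mode (2 * N + 1) a m * sine_mode (2 * N + 1) b m) = (if a = b then 1 else 0)"
  using sine_mode_orthonormal[of a "2 * N + 1" b] assms
  by (simp add: atLeastLessThanSuc_atLeastAtMost)

lemma alt_mode_orthonormal:
  assumes j: "j \<in> {1..2 * N}" and k: "k \<in> {1..2 * N}"
  shows "(\<Sum>m=1..2 * N. alt_mode N j m * alt_mode N k m) = (if j = k then 1 else 0)"
proof -
  let ?s = "sine_mode (2 * N + 1)" and ?n = "2 * N + 1"
  have "(\<Sum>m=1..2 * N. alt_mode N j m * alt_mode N k m) = mode_scale N j * mode_scale N k *
     ((\<Sum>m=1..2 * N. ?s j m * ?s k m) + mode_slope N k * (\<Sum>m=1..2 * N. ?s j m * ?s (?n - k) m)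
      + mode_slope N j * (\<Sum>m=1..2 * N. ?s (?n - j) m * ?s k m)
      + mode_slope N j * mode_slope N k * (\<Sum>m=1..2 * N. ?s (?n - j) m * ?s (?n - k) m))"
    by (simp add: alt_mode_def sum_distrib_left algebra_simps sum.distrib)
  also have "\<dots> = mode_scale N j * mode_scale N k *
     ((if j = k then 1 else 0) + mode_slope N k * (if j = ?n - k then 1 else 0)
      + mode_slope N j * (if ?n - j = k then 1 else 0)
      + mode_slope N j * mode_slope N k * (if ?n - j = ?n - k then 1 else 0))"
    using j k by (subst (1 2 3 4) sine_mode_orthonormal') auto
  also have "\<dots> = (if j = k then 1 else 0)"
  proof -
    consider "j = k" | "j = ?n - k" "j \<noteq> k" | "j \<noteq> k" "j \<noteq> ?n - k" by blast
    then show ?thesis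
    proof cases
      case 1
      \<comment> \<open>An index equal to its own reflection would make the odd number
        \<open>2 * N + 1\<close> even.\<close>
      then have "j \<noteq> ?n - k" "?n - j \<noteq> k" using k by presburger+
      with 1 show ?thesis using mode_scale_sq[of N k] by (simp add: power2_eq_square)
    next
      case 2
      then have "?n - j = k" "?n - j \<noteq> ?n - k" using j k by auto
      with 2 show ?thesis using mode_slope_reflect[OF k] by simp
    next
      case 3
      then have "?n - j \<noteq> k" "?n - j \<noteq> ?n - k" using j k by auto
      with 3 show ?thesis by simp
    qed
  qed
  finally show ?thesis .
qed

text \<open>Reindexing half of the terms by \<open>k \<mapsto> n - k\<close> cancels the cross
  terms, since the slope is odd, and collects the squares with weight
  \<open>mode_scale\<^sup>2 * (1 + mode_slope\<^sup>2) = 1\<close>. Orthonormality of the sine modes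
  remains. The identity supplies explicit expansion coefficients for the basis.\<close>

lemma alt_mode_complete:
  assumes x: "x \<in> {1..2 * N}" and y: "y \<in> {1..2 * N}"
  shows "(\<Sum>k=1..2 * N. alt_mode N k x * alt_mode N k y) = (if x = y then 1 else 0)"
proof -
  let ?s = "sine_mode (2 * N + 1)" and ?n = "2 * N + 1"
  let ?a = "mode_scale N" and ?t = "mode_slope N"
  have reflect: "(\<Sum>k=1..2 * N. f k) = (\<Sum>k=1..2 * N. f (?n - k))" for f :: "nat \<Rightarrow> real"
    by (subst sum.atLeastAtMost_rev) (simp add: Suc_diff_le)
  have "(\<Sum>k=1..2 * N. alt_mode N k x * alt_mode N k y) =
     (\<Sum>k=1..2 * N. (?a k)\<^sup>2 * ?s k x * ?s k y + (?a k)\<^sup>2 * ?t k * ?s k x * ?s (?n - k) y)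
     + (\<Sum>k=1..2 * N. (?a k)\<^sup>2 * (?t k)\<^sup>2 * ?s (?n - k) x * ?s (?n - k) y
          + (?a k)\<^sup>2 * ?t k * ?s (?n - k) x * ?s k y)"
    by (simp add: alt_mode_def algebra_simps power2_eq_square flip: sum.distrib)
  also have "(\<Sum>k=1..2 * N. (?a k)\<^sup>2 * (?t k)\<^sup>2 * ?s (?n - k) x * ?s (?n - k) y
          + (?a k)\<^sup>2 * ?t k * ?s (?n - k) x * ?s k y) =
      (\<Sum>k=1..2 * N. (?a k)\<^sup>2 * (?t k)\<^sup>2 * ?s k x * ?s k y
          - (?a k)\<^sup>2 * ?t k * ?s k x * ?s (?n - k) y)"
    by (subst reflect, rule sum.cong)
       (auto simp: mode_scale_reflect[simplified] mode_slope_reflect[simplified])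
  also have "(\<Sum>k=1..2 * N. (?a k)\<^sup>2 * ?s k x * ?s k y + (?a k)\<^sup>2 * ?t k * ?s k x * ?s (?n - k) y) + \<dots>
      = (\<Sum>k=1..2 * N. ((?a k)\<^sup>2 * (1 + (?t k)\<^sup>2)) * (?s k x * ?s k y))"
    by (simp add: algebra_simps flip: sum.distrib)
  also have "\<dots> = (\<Sum>k=1..2 * N. ?s x k * ?s y k)"
    unfolding mode_scale_sq by (simp add: sine_mode_commute)
  also have "\<dots> = (if x = y then 1 else 0)"
    using x y by (rule sine_mode_orthonormal')
  finally show ?thesis .
qed

text \<open>The sign swaps the two sine modes up to a minus, so by orthonormality only the two
  products weighted by \<open>mode_slope\<close> survive.\<close>

lemma alt_mode_expectation:
  assumes k: "k \<in> {1..2 * N}"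
  shows "(\<Sum>m=1..2 * N. (-1) ^ m * (alt_mode N k m)\<^sup>2) = 1 / mode_energy N k"
proof -
  let ?n = "2 * N + 1"
  let ?s = "sine_mode (2 * N + 1)" and ?t = "mode_slope N k"
  have "(-1) ^ m * (alt_mode N k m)\<^sup>2 = - ((mode_scale N k)\<^sup>2 *
      (?s k m + ?t * ?s (?n - k) m) * (?s (?n - k) m + ?t * ?s k m))" for m
  proof -
    have "(-1) ^ m * ?s k m = - ?s (?n - k) m" "(-1) ^ m * ?s (?n - k) m = - ?s k m"
      using sine_mode_reflect[of k ?n m] k by simp_all
    then have "(-1) ^ m * (?s k m + ?t * ?s (?n - k) m) = - (?s (?n - k) m + ?t * ?s k m)"
      by (simp only: distrib_left mult.left_commute[of _ ?t])
    moreover have "(-1) ^ m * (alt_mode N k m)\<^sup>2 = (mode_scale N k)\<^sup>2 *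
        (?s k m + ?t * ?s (?n - k) m) * ((-1) ^ m * (?s k m + ?t * ?s (?n - k) m))"
      by (simp only: alt_mode_def power2_eq_square mult_ac)
    ultimately show ?thesis
      by (simp only: mult_minus_right)
  qed
  then have "(\<Sum>m=1..2 * N. (-1) ^ m * (alt_mode N k m)\<^sup>2) = (\<Sum>m=1..2 * N. - ((mode_scale N k)\<^sup>2 *
      (?s k m + ?t * ?s (?n - k) m) * (?s (?n - k) m + ?t * ?s k m)))"
    by (simp only:)
  also have "\<dots> = - ((mode_scale N k)\<^sup>2 *
      ((1 + ?t\<^sup>2) * (\<Sum>m=1..2 * N. ?s k m * ?s (?n - k) m) + ?t * (\<Sum>m=1..2 * N. ?s k m * ?s k m)
        + ?t * (\<Sum>m=1..2 * N. ?s (?n - k) m * ?s (?n - k) m)))"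
    unfolding sum_negf sum_distrib_left sum.distrib[symmetric]
    by (simp add: power2_eq_square algebra_simps)
  also have "\<dots> = - ((mode_scale N k)\<^sup>2 * ((1 + ?t\<^sup>2) * (if k = ?n - k then 1 else 0) + ?t + ?t))"
    using k by (subst (1 2 3) sine_mode_orthonormal') auto
  also have "\<dots> = - ((mode_scale N k)\<^sup>2 * (2 * ?t))"
  proof -
    have "k \<noteq> ?n - k" using k by presburger
    then show ?thesis by simp
  qed
  \<comment> \<open>The normalisation now reads
    \<open>mode_scale\<^sup>2 * (- 2 * E * t) = 1\<close>; divide by \<open>E\<close>.\<close>
  also have "\<dots> = 1 / mode_energy N k"
    using mode_scale_sq[of N k] mode_energy_nonzero[of N k]
    unfolding mode_slope_energy by (simp add: field_simps)
  finally show ?thesis .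
qed

section \<open>The one-dimensional box\<close>

text \<open>Period 2 gives \<open>2 * N\<close> sites, the path with boundary sites \<open>0\<close>
  and \<open>2 * N + 1\<close>.\<close>

abbreviation line_box :: "nat \<Rightarrow> point set" where
  "line_box \<equiv> lattice_box 1 (\<lambda>_. 2)"

definition line_point :: "nat \<Rightarrow> point" where
  "line_point m = (\<lambda>i\<in>{1..1}. int m)"

definition alt_sign :: "point \<Rightarrow> real" where
  "alt_sign x = (if even (x 1) then 1 else -1)"

definition line_fun :: "nat \<Rightarrow> (nat \<Rightarrow> real) \<Rightarrow> point \<Rightarrow> complex" where
  "line_fun N u = (\<lambda>x\<in>line_box N. complex_of_real (u (nat (x 1))))"

lemma line_point_1 [simp]: "line_point m 1 = int m" "line_point m (Suc 0) = int m"
  by (simp_all add: line_point_def)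

lemma bij_betw_line_point: "bij_betw line_point {1..2 * N} (line_box N)"
proof (rule bij_betw_byWitness[where f' = "\<lambda>x. nat (x 1)"])
  show "\<forall>m\<in>{1..2 * N}. nat (line_point m 1) = m"
    by simp
  have box: "x 1 \<in> {1..int (2 * N)}" "i \<noteq> 1 \<Longrightarrow> x i = undefined" if "x \<in> line_box N" for x i
    using PiE_mem[OF that[unfolded lattice_box_def], of 1] PiE_arb[OF that[unfolded lattice_box_def], of i]
    by simp_all
  show "\<forall>x\<in>line_box N. line_point (nat (x 1)) = x"
  proof (intro ballI ext)
    fix x i
    assume "x \<in> line_box N"
    from box[OF this] show "line_point (nat (x 1)) i = x i"
      by (cases "i = 1") (simp_all add: line_point_def)
  qed
  show "line_point ` {1..2 * N} \<subseteq> line_box N"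
    unfolding lattice_box_def line_point_def by (intro image_subsetI restrict_PiE_iff[THEN iffD2]) simp
  show "(\<lambda>x. nat (x 1)) ` line_box N \<subseteq> {1..2 * N}"
    using box(1) by (fastforce simp del: One_nat_def)
qed

lemma line_point_in_box: "m \<in> {1..2 * N} \<Longrightarrow> line_point m \<in> line_box N"
  using bij_betw_line_point by (rule bij_betw_apply)

lemma line_boxE:
  assumes "x \<in> line_box N"
  obtains m where "m \<in> {1..2 * N}" "x = line_point m"
  using assms bij_betw_imp_surj_on[OF bij_betw_line_point[of N]] by blast

lemma sum_line_box: "sum f (line_box N) = (\<Sum>m=1..2 * N. f (line_point m))"
  by (rule sum.reindex_bij_betw[OF bij_betw_line_point, symmetric])

lemma card_line_box [simp]: "card (line_box N) = 2 * N"
  using bij_betw_same_card[OF bij_betw_line_point[of N]] by simp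

lemma finite_line_box: "finite (line_box N)"
  using bij_betw_finite[OF bij_betw_line_point[of N]] by simp

lemma alt_sign_line_point [simp]: "alt_sign (line_point m) = (-1) ^ m"
  by (simp add: alt_sign_def)

lemma line_fun_line_point:
  "m \<in> {1..2 * N} \<Longrightarrow> line_fun N u (line_point m) = complex_of_real (u m)"
  using line_point_in_box[of m N] by (simp add: line_fun_def del: One_nat_def)

lemma line_fun_in_ell2: "line_fun N u \<in> ell2 (line_box N)"
  by (simp add: line_fun_def ell2_def)

text \<open>Because \<open>u\<close> vanishes at both boundary sites, a neighbour cut off by the
  truncation may be added back, giving a three-term recurrence valid also at the ends.\<close>

lemma dirichlet_op_line_fun:
  assumes m: "m \<in> {1..2 * N}" and u: "u 0 = 0" "u (2 * N + 1) = 0"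
  shows "dirichlet_op 1 (\<lambda>_. 2) alt_sign N (line_fun N u) (line_point m)
    = complex_of_real (u (m - 1) + u (m + 1) + (-1) ^ m * u m)"
proof -
  have "(\<Sum>y | y \<in> line_box N \<and> dist1 1 y (line_point m) = 1. line_fun N u y)
      = (\<Sum>y\<in>line_box N. if dist1 1 y (line_point m) = 1 then line_fun N u y else 0)"
    by (rule sum.inter_filter) (rule finite_line_box)
  also have "\<dots> = (\<Sum>i=1..2 * N. if \<bar>int i - int m\<bar> = 1 then complex_of_real (u i) else 0)"
    unfolding sum_line_box by (rule sum.cong) (simp_all add: dist1_def line_fun_line_point del: One_nat_def)
  also have "\<dots> = (\<Sum>i\<in>{i\<in>{1..2 * N}. \<bar>int i - int m\<bar> = 1}. complex_of_real (u i))"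
    by (rule sum.inter_filter[symmetric]) simp
  also have "\<dots> = (\<Sum>i\<in>{m - 1, m + 1}. complex_of_real (u i))"
  proof (rule sum.mono_neutral_left)
    show "{i \<in> {1..2 * N}. \<bar>int i - int m\<bar> = 1} \<subseteq> {m - 1, m + 1}"
      by auto
    show "\<forall>i\<in>{m - 1, m + 1} - {i \<in> {1..2 * N}. \<bar>int i - int m\<bar> = 1}. complex_of_real (u i) = 0"
    proof
      fix i assume i: "i \<in> {m - 1, m + 1} - {i \<in> {1..2 * N}. \<bar>int i - int m\<bar> = 1}"
      then have "i = 0 \<or> i = 2 * N + 1" using m by auto
      then show "complex_of_real (u i) = 0" using u by auto
    qed
  qed simp
  also have "\<dots> = complex_of_real (u (m - 1) + u (m + 1))"
    by (subst sum.insert) auto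
  finally show ?thesis
    using line_point_in_box[OF m] line_fun_line_point[OF m]
    by (simp add: dirichlet_op_def del: One_nat_def)
qed

lemma periodic_alt_sign: "periodic_potential 1 (\<lambda>_. 2) alt_sign"
proof -
  have "even (y 1)" if "y \<in> period_lattice 1 (\<lambda>_. 2)" for y
    using that by (auto simp: period_lattice_def)
  then show ?thesis
    by (auto simp: periodic_potential_def padd_def alt_sign_def)
qed

section \<open>The eigenbasis on the box and its quantum variance\<close>

lemma eigenbasis_line_fun:
  "eigenbasis (line_box N) (dirichlet_op 1 (\<lambda>_. 2) alt_sign N) (\<lambda>k. line_fun N (alt_mode N k))"
  unfolding eigenbasis_def card_line_box
proof
  let ?\<psi> = "\<lambda>k. line_fun N (alt_mode N k)"
  have inner: "ell2_inner (line_box N) (?\<psi> j) (?\<psi> k) = (if j = k then 1 else 0)"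
    if "j \<in> {1..2 * N}" "k \<in> {1..2 * N}" for j k
  proof -
    have "ell2_inner (line_box N) (?\<psi> j) (?\<psi> k) = of_real (\<Sum>m=1..2 * N. alt_mode N j m * alt_mode N k m)"
      unfolding ell2_inner_def sum_line_box of_real_sum
      by (rule sum.cong) (simp_all add: line_fun_line_point del: One_nat_def)
    then show ?thesis
      unfolding alt_mode_orthonormal[OF that] by simp
  qed
  have "\<exists>c. \<phi> = (\<lambda>x\<in>line_box N. \<Sum>j\<in>{1..2 * N}. c j * ?\<psi> j x)" if \<phi>: "\<phi> \<in> ell2 (line_box N)" for \<phi>
  proof (intro exI ext)
    fix x
    \<comment> \<open>The inner products of the basis functions with \<phi>; the modes are real, so
      no conjugate appears.\<close>
    let ?c = "\<lambda>j. \<Sum>m=1..2 * N. complex_of_real (alt_mode N j m) * \<phi> (line_point m)"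
    show "\<phi> x = (\<lambda>x\<in>line_box N. \<Sum>j\<in>{1..2 * N}. ?c j * ?\<psi> j x) x"
    proof (cases "x \<in> line_box N")
      case True
      then obtain m where m: "m \<in> {1..2 * N}" "x = line_point m" by (rule line_boxE)
      have "(\<Sum>j\<in>{1..2 * N}. ?c j * ?\<psi> j x) =
          (\<Sum>j=1..2 * N. \<Sum>i=1..2 * N. of_real (alt_mode N j i * alt_mode N j m) * \<phi> (line_point i))"
        unfolding m(2) line_fun_line_point[OF m(1)] sum_distrib_right by (simp add: mult_ac)
      also have "\<dots> = (\<Sum>i=1..2 * N. of_real (\<Sum>j=1..2 * N. alt_mode N j i * alt_mode N j m) * \<phi> (line_point i))"
        by (subst sum.swap) (simp add: sum_distrib_right)
      also have "\<dots> = (\<Sum>i=1..2 * N. if i = m then \<phi> (line_point i) else 0)"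
      proof (rule sum.cong[OF refl])
        fix i assume i: "i \<in> {1..2 * N}"
        show "of_real (\<Sum>j=1..2 * N. alt_mode N j i * alt_mode N j m) * \<phi> (line_point i) =
            (if i = m then \<phi> (line_point i) else 0)"
          unfolding alt_mode_complete[OF i m(1)] by simp
      qed
      also have "\<dots> = \<phi> x"
        using m by simp
      finally show ?thesis
        using True by simp
    next
      case False
      then show ?thesis
        \<comment> \<open>Off the box both sides are \<open>undefined\<close> by
          extensionality.\<close>
        using PiE_arb[OF \<phi>[unfolded ell2_def] False] by simp
    qed
  qed
  then show "orthonormal_basis (line_box N) {1..2 * N} ?\<psi>"
    unfolding orthonormal_basis_def by (intro conjI ballI inner line_fun_in_ell2)
  show "\<forall>j\<in>{1..2 * N}. eigenfunction (line_box N) (dirichlet_op 1 (\<lambda>_. 2) alt_sign N) (?\<psi> j)"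
  proof
    fix j assume j: "j \<in> {1..2 * N}"
    \<comment> \<open>The zero function would have inner product 0 with itself instead of 1.\<close>
    have "?\<psi> j \<noteq> (\<lambda>x\<in>line_box N. 0)"
      using inner[OF j j] by (auto simp: ell2_inner_def)
    moreover have "dirichlet_op 1 (\<lambda>_. 2) alt_sign N (?\<psi> j) =
        (\<lambda>x\<in>line_box N. of_real (mode_energy N j) * ?\<psi> j x)"
    proof
      fix x
      show "dirichlet_op 1 (\<lambda>_. 2) alt_sign N (?\<psi> j) x =
          (\<lambda>x\<in>line_box N. of_real (mode_energy N j) * ?\<psi> j x) x"
      proof (cases "x \<in> line_box N")
        case True
        then obtain m where m: "m \<in> {1..2 * N}" "x = line_point m" by (rule line_boxE)
        have "m \<ge> 1" using m(1) by simp
        have "dirichlet_op 1 (\<lambda>_. 2) alt_sign N (?\<psi> j) x = of_real (mode_energy N j * alt_mode N j m)"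
          unfolding m(2) dirichlet_op_line_fun[OF m(1) alt_mode_boundary] alt_mode_eigen[OF j \<open>m \<ge> 1\<close>] ..
        then show ?thesis
          using True m line_fun_line_point[OF m(1)] by simp
      next
        case False
        then show ?thesis by (simp add: dirichlet_op_def)
      qed
    qed
    ultimately show "eigenfunction (line_box N) (dirichlet_op 1 (\<lambda>_. 2) alt_sign N) (?\<psi> j)"
      unfolding eigenfunction_def using line_fun_in_ell2 by blast
  qed
qed

lemma quantum_variance_alt_sign:
  assumes N: "N \<ge> 1"
  shows "quantum_variance (line_box N) (\<lambda>k. line_fun N (alt_mode N k))
     (\<lambda>x y. if x = y then of_real (alt_sign x) else 0) \<ge> 1 / 5"
proof -
  let ?\<psi> = "\<lambda>k. line_fun N (alt_mode N k)"
  have mean: "(\<Sum>x\<in>line_box N. complex_of_real (alt_sign x)) = 0"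
  proof -
    \<comment> \<open>The box has an even number of sites, so consecutive signs cancel in
      pairs.\<close>
    have "(\<Sum>m=1..2 * N. (-1 :: complex) ^ m) = 0"
      by (induction N) auto
    then show ?thesis by (simp only: sum_line_box alt_sign_line_point of_real_power of_real_minus of_real_1)
  qed
  have expectation: "(\<Sum>x\<in>line_box N. complex_of_real (alt_sign x) * of_real ((cmod (?\<psi> j x))\<^sup>2))
      = of_real (1 / mode_energy N j)" if "j \<in> {1..2 * N}" for j
    unfolding alt_mode_expectation[OF that, symmetric] sum_line_box of_real_sum
    by (rule sum.cong) (simp_all add: line_fun_line_point del: One_nat_def)
  \<comment> \<open>Every eigenfunction contributes at least \<open>1 / 5\<close>, so the average
    over \<open>j\<close> does too.\<close>
  have "(\<Sum>j=1..2 * N. (1 :: real) / 5) \<le> (\<Sum>j=1..2 * N. (cmod (of_real (1 / mode_energy N j)))\<^sup>2)"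
  proof (rule sum_mono)
    fix j
    have "0 < (mode_energy N j)\<^sup>2" using mode_energy_nonzero by simp
    then have "1 / 5 \<le> 1 / (mode_energy N j)\<^sup>2"
      by (intro divide_left_mono) (auto simp: mode_energy_sq_le)
    then show "1 / 5 \<le> (cmod (of_real (1 / mode_energy N j)))\<^sup>2"
      by (simp only: norm_of_real power2_abs power_divide power_one)
  qed
  then have "real (2 * N) / 5 \<le> (\<Sum>j=1..2 * N. (cmod (of_real (1 / mode_energy N j)))\<^sup>2)"
    by simp
  also have "\<dots> = (\<Sum>j=1..2 * N.
      (cmod ((\<Sum>x\<in>line_box N. of_real (alt_sign x) * of_real ((cmod (?\<psi> j x))\<^sup>2)) - 0))\<^sup>2)"
    by (rule sum.cong) (simp_all only: expectation diff_zero)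
  finally show ?thesis
    using N by (simp only: quantum_variance_def card_line_box mean mult_zero_right if_True simp_thms)
      (simp add: field_simps)
qed

theorem proposition1p4:
  shows "\<exists>(d :: nat) (q :: nat \<Rightarrow> nat) (V :: point \<Rightarrow> real).
           d \<ge> 1 \<and> (\<forall>l\<in>{1..d}. q l \<ge> 1) \<and> periodic_potential d q V \<and>
           \<not> quantum_ergodic (lattice_box d q) (dirichlet_op d q V)"
proof (intro exI conjI)
  show "periodic_potential 1 (\<lambda>_. 2) alt_sign"
    by (rule periodic_alt_sign)
  show "\<not> quantum_ergodic line_box (dirichlet_op 1 (\<lambda>_. 2) alt_sign)"
  proof
    let ?\<psi> = "\<lambda>N k. line_fun N (alt_mode N k)"
    let ?a = "\<lambda>(N :: nat) x y. if x = y then complex_of_real (alt_sign x) else 0"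
    assume ergodic: "quantum_ergodic line_box (dirichlet_op 1 (\<lambda>_. 2) alt_sign)"
    have lim: "(\<lambda>N. quantum_variance (line_box N) (?\<psi> N) (?a N)) \<longlonglongrightarrow> 0"
    proof (rule ergodic[unfolded quantum_ergodic_def, THEN spec, THEN spec, THEN mp, THEN mp])
      show "\<forall>N\<ge>1. eigenbasis (line_box N) (dirichlet_op 1 (\<lambda>_. 2) alt_sign N) (?\<psi> N)"
        using eigenbasis_line_fun by blast
      show "\<forall>N\<ge>1. diagonal_observable (line_box N) (?a N) \<and> (\<forall>x\<in>line_box N. cmod (?a N x x) \<le> 1)"
        by (simp add: diagonal_observable_def alt_sign_def)
    qed
    \<comment> \<open>The lower bound is uniform in \<open>N \<ge> 1\<close> and passes to the
      supposed limit 0.\<close>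
    have "1 / 5 \<le> (0 :: real)"
      by (rule LIMSEQ_le_const[OF lim]) (intro exI[of _ 1] allI impI quantum_variance_alt_sign)
    then show False by simp
  qed
qed auto

end
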